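(* Let $N\ge 3$ be an integer, let $g_0,\dots,g_{N-1}>0$ be real numbers, and set $l_n=g_n^{-1/2}>0$ (so $g_n=l_n^{-2}$) and $L=\sum_{n=0}^{N-1}l_n$. For $k\in\mathbb{R}$ let $M(k)$ be the Hermitian $N\times N$ matrix defined in the context, and let its eigenvalues, counted with multiplicity and listed in increasing order, be $\omega_0^2(k)\le\dots\le\omega_{N-1}^2(k)$. Then exactly one of these eigenvalue branches, namely the lowest one, tends to $0$ as $k\to 0$; denoting it $\omega_{\mathrm{ac}}^2(k)$, one has, as $k\to0$, $$\omega_{\mathrm{ac}}^2(k)=\frac{L^2}{N^2}\,\frac{1}{\overline{g^{-1}}}\,k^2+\left(\frac{L^4}{N^6}\,\frac{\sum_{0\le i<j\le N-1}c_{ij}\,g_i^{-1}g_j^{-1}}{\left(\overline{g^{-1}}\right)^3}-\frac{1}{12N^2}\,\frac{L^4}{\overline{g^{-1}}}\right)k^4+O(k^6),$$ equivalently $$\omega_{\mathrm{ac}}^2(k)=\frac{\overline{l}^{\,2}}{\overline{l^2}}\,k^2+\left(\frac{1}{L^2}\,\frac{\overline{l}^{\,6}}{\left(\overline{l^2}\right)^3}\sum_{0\le i<j\le N-1}c_{ij}\,l_i^2l_j^2-\frac{L^2}{12}\,\frac{\overline{l}^{\,2}}{\overline{l^2}}\right)k^4+O(k^6).$$ Here $c_{ij}=(j-i)[N-(j-i)]$ and $\overline{f}=\frac1N\sum_{n=0}^{N-1}f_n$.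
   Context: For $N\ge3$, $g_0,\dots,g_{N-1}>0$, $L>0$ and $k\in\mathbb{R}$, the matrix $M=M(k)$, with rows and columns indexed by $0,\dots,N-1$, is $$M=\begin{pmatrix} g_{N-1}+g_0&-g_0&0&\cdots&0&-g_{N-1}e^{ikL}\\ -g_0&g_0+g_1&-g_1&0&\cdots&0\\ 0&-g_1&g_1+g_2&-g_2&0&\cdots\\ \vdots&&\ddots&\ddots&\ddots&\vdots\\ -g_{N-1}e^{-ikL}&0&\cdots&0&-g_{N-2}&g_{N-2}+g_{N-1}\end{pmatrix}.$$ That is, $M_{n,n}=g_{n-1}+g_n$ (with $g_{-1}:=g_{N-1}$), $M_{n,n+1}=M_{n+1,n}=-g_n$ for $0\le n\le N-2$, $M_{0,N-1}=-g_{N-1}e^{ikL}$, $M_{N-1,0}=-g_{N-1}e^{-ikL}$, and all other entries are $0$. For a sequence $f_0,\dots,f_{N-1}$, $\overline f=\frac1N\sum_{n=0}^{N-1}f_n$; in particular $\overline{g^{-1}}=\frac1N\sum_n g_n^{-1}$, $\overline{l}=\frac1N\sum_n l_n=L/N$, $\overline{l^2}=\frac1N\sum_n l_n^2$. *)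

theory Defs
  imports
    "HOL-Library.Landau_Symbols"
    "HOL-Computational_Algebra.Fundamental_Theorem_Algebra"
    "Jordan_Normal_Form.Char_Poly"
    "Jordan_Normal_Form.Schur_Decomposition"
begin

text \<open>
  The parameter \<open>L\<close> is kept independent of \<open>g\<close> here. The case distinction reproduces the
  displayed matrix for \<open>N \<ge> 3\<close>, where the corner entries do not lie on the three diagonals.
\<close>
definition dyn_matrix :: "nat \<Rightarrow> (nat \<Rightarrow> real) \<Rightarrow> real \<Rightarrow> real \<Rightarrow> complex mat" where
  "dyn_matrix N g L k = mat N N (\<lambda>(m, n).
     if m = n then complex_of_real (g (if n = 0 then N - 1 else n - 1) + g n)
     else if n = m + 1 then - complex_of_real (g m)
     else if m = n + 1 then - complex_of_real (g n)
     else if m = 0 \<and> n = N - 1 then - (complex_of_real (g (N - 1)) * cis (k * L))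
     else if m = N - 1 \<and> n = 0 then - (complex_of_real (g (N - 1)) * cis (- (k * L)))
     else 0)"

text \<open>
  Taking real parts loses nothing for Hermitian matrices: see
  \<open>char_poly_sorted_eigenvalues\<close> below.
\<close>
definition sorted_eigenvalues :: "complex mat \<Rightarrow> real list" where
  "sorted_eigenvalues A = sorted_list_of_multiset (image_mset Re (proots (char_poly A)))"

definition omega_sq :: "nat \<Rightarrow> (nat \<Rightarrow> real) \<Rightarrow> real \<Rightarrow> nat \<Rightarrow> real \<Rightarrow> real" where
  "omega_sq N g L n k = sorted_eigenvalues (dyn_matrix N g L k) ! n"

definition avg :: "nat \<Rightarrow> (nat \<Rightarrow> real) \<Rightarrow> real" where
  "avg N f = (\<Sum>n<N. f n) / real N"

definition c_coeff :: "nat \<Rightarrow> nat \<Rightarrow> nat \<Rightarrow> real" where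
  "c_coeff N i j = (real j - real i) * (real N - (real j - real i))"

lemma dyn_matrix_carrier [simp]: "dyn_matrix N g L k \<in> carrier_mat N N"
  by (simp add: dyn_matrix_def)

lemma dyn_matrix_hermitian:
  assumes "N \<ge> 3"
  shows "mat_adjoint (dyn_matrix N g L k) = dyn_matrix N g L k"
proof (rule eq_matI)
  fix i j
  assume "i < dim_row (dyn_matrix N g L k)" "j < dim_col (dyn_matrix N g L k)"
  then have "i < N" "j < N" by (auto simp: dyn_matrix_def)
  with assms show "mat_adjoint (dyn_matrix N g L k) $$ (i, j) = dyn_matrix N g L k $$ (i, j)"
    by (auto simp: mat_adjoint_def dyn_matrix_def mat_of_rows_def cis_cnj)
qed (auto simp: mat_adjoint_def dyn_matrix_def)

lemma hermitian_eigenvalue_real: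
  fixes A :: "complex mat"
  assumes A: "A \<in> carrier_mat n n" and herm: "mat_adjoint A = A" and ev: "eigenvalue A x"
  shows "Im x = 0"
proof -
  from ev A obtain v where v: "v \<in> carrier_vec n" "v \<noteq> 0\<^sub>v n" and Av: "A *\<^sub>v v = x \<cdot>\<^sub>v v"
    by (auto simp: eigenvalue_def eigenvector_def)
  have sym: "cnj (A $$ (i, j)) = A $$ (j, i)" if "i < n" "j < n" for i j
  proof -
    have "A $$ (j, i) = mat_adjoint A $$ (j, i)" by (simp add: herm)
    also have "\<dots> = cnj (A $$ (i, j))"
      using A that by (simp add: mat_adjoint_def mat_of_rows_def)
    finally show ?thesis by simp
  qed
  define q where "q = (\<Sum>i<n. \<Sum>j<n. A $$ (i, j) * v $ j * cnj (v $ i))"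
  define s where "s = (\<Sum>i<n. (cmod (v $ i))\<^sup>2)"
  have row: "(\<Sum>j<n. A $$ (i, j) * v $ j) = x * v $ i" if "i < n" for i
  proof -
    have "(A *\<^sub>v v) $ i = x * v $ i"
      using that v by (simp add: Av)
    moreover have "(A *\<^sub>v v) $ i = (\<Sum>j<n. A $$ (i, j) * v $ j)"
      using that v A by (simp add: scalar_prod_def atLeast0LessThan)
    ultimately show ?thesis by simp
  qed
  have q: "q = x * of_real s"
  proof -
    have "q = (\<Sum>i<n. (\<Sum>j<n. A $$ (i, j) * v $ j) * cnj (v $ i))"
      by (simp add: q_def sum_distrib_right)
    also have "\<dots> = (\<Sum>i<n. x * of_real ((cmod (v $ i))\<^sup>2))"
      by (intro sum.cong) (auto simp: row complex_norm_square mult.assoc simp del: of_real_power)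
    finally show ?thesis by (simp add: s_def sum_distrib_left)
  qed
  have "cnj q = (\<Sum>i<n. \<Sum>j<n. A $$ (j, i) * v $ i * cnj (v $ j))"
    by (auto simp: q_def sym mult_ac intro!: sum.cong)
  also have "\<dots> = q"
    unfolding q_def by (rule sum.swap)
  finally have "Im q = 0"
    by (simp add: complex_eq_iff)
  moreover have "s \<noteq> 0"
  proof
    assume "s = 0"
    then have "v $ i = 0" if "i < n" for i
      using that by (simp add: s_def sum_nonneg_eq_0_iff)
    with v show False by auto
  qed
  ultimately show ?thesis by (simp add: q)
qed

lemma length_sorted_eigenvalues:
  assumes "A \<in> carrier_mat n n"
  shows "length (sorted_eigenvalues A) = n"
proof -
  have "length (sorted_eigenvalues A) = size (image_mset Re (proots (char_poly A)))"
    unfolding sorted_eigenvalues_def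
    by (metis mset_sorted_list_of_multiset size_mset)
  also have "\<dots> = n"
    using degree_monic_char_poly[OF assms] by (simp add: size_proots_complex)
  finally show ?thesis .
qed

lemma char_poly_sorted_eigenvalues:
  assumes A: "A \<in> carrier_mat n n" and herm: "mat_adjoint A = A"
  shows "char_poly A = (\<Prod>x\<leftarrow>sorted_eigenvalues A. [:- complex_of_real x, 1:])"
proof -
  let ?p = "char_poly A"
  have p: "lead_coeff ?p = 1" "?p \<noteq> 0"
    using degree_monic_char_poly[OF A] by auto
  have re: "complex_of_real (Re x) = x" if "x \<in># proots ?p" for x
  proof -
    have "eigenvalue A x"
      using that p by (simp add: eigenvalue_root_char_poly[OF A])
    from hermitian_eigenvalue_real[OF A herm this] show ?thesis
      by (simp add: complex_eq_iff)
  qed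
  have "?p = (\<Prod>x\<in>#proots ?p. [:- x, 1:])"
    using complex_poly_decompose_multiset[of ?p] p by simp
  also have "\<dots> = (\<Prod>x\<in>#proots ?p. [:- complex_of_real (Re x), 1:])"
    by (intro arg_cong[where f = prod_mset] image_mset_cong) (simp add: re)
  also have "\<dots> = (\<Prod>x\<in>#mset (sorted_eigenvalues A). [:- complex_of_real x, 1:])"
    by (simp add: sorted_eigenvalues_def multiset.map_comp o_def)
  also have "\<dots> = (\<Prod>x\<leftarrow>sorted_eigenvalues A. [:- complex_of_real x, 1:])"
    by (simp flip: prod_mset_prod_list)
  finally show ?thesis .
qed

end

theory Submission
  imports Defs "HOL-Real_Asymp.Real_Asymp"
begin

text \<open>
  With the spring force \<open>p\<close> as second unknown, \<open>M(k) v = x v\<close> is the recursion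
  \<open>p (n + 1) = p n - x u n\<close>, \<open>u (n + 1) = u n + p (n + 1) / g n\<close> with the Bloch condition
  \<open>(u N, p N) = e\<^sup>-\<^sup>i\<^sup>k\<^sup>L (u 0, p 0)\<close>. The monodromy matrix has determinant \<open>1\<close>, so every eigenvalue
  satisfies \<open>f x = 2 cos (k L)\<close>, where the trace \<open>f\<close> is a polynomial not depending on \<open>k\<close>
  whose first three coefficients are \<open>2\<close>, \<open>- N \<Sum> 1 / g i\<close> and \<open>\<Sum> c i j / (g i g j)\<close>. Inverting
  this relation at \<open>x = 0\<close> yields the expansion of any branch that tends to \<open>0\<close>.

  The lowest branch does, since \<open>M(k)\<close> is positive semidefinite and \<open>det M(k)\<close> tends to
  \<open>det M(0) = 0\<close>. No other branch does: the two lowest eigenvectors have a nonzero combination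
  that vanishes at site \<open>0\<close>, and there a discrete Poincare inequality, uniform in \<open>k\<close>, bounds the
  energy from below.
\<close>

section \<open>The monodromy of the chain\<close>

text \<open>Pairs are (displacement, force) as polynomials in the spectral parameter
  \<open>[:0, 1:]\<close>; \<open>h n\<close> stands for \<open>1 / g n\<close>. The force is
  updated first and then moves the displacement, so a step is a product of two shears.\<close>

primrec transfer :: "(nat \<Rightarrow> real) \<Rightarrow> real poly \<times> real poly \<Rightarrow> nat \<Rightarrow> real poly \<times> real poly" where
  "transfer h s 0 = s"
| "transfer h s (Suc n) =
     (let p = snd (transfer h s n) - [:0, 1:] * fst (transfer h s n)
      in (fst (transfer h s n) + smult (h n) p, p))"

text \<open>The trace of the monodromy matrix, whose columns are the images of the two basis
  states.\<close>

definition discriminant :: "(nat \<Rightarrow> real) \<Rightarrow> nat \<Rightarrow> real poly" where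
  "discriminant h n = fst (transfer h (1, 0) n) + snd (transfer h (0, 1) n)"

lemma transfer_Suc:
  "snd (transfer h s (Suc n)) = snd (transfer h s n) - [:0, 1:] * fst (transfer h s n)"
  "fst (transfer h s (Suc n)) = fst (transfer h s n) + [:h n:] * (snd (transfer h s n) - [:0, 1:] * fst (transfer h s n))"
  by (simp_all add: Let_def)

text \<open>This is the determinant of the monodromy, which shears preserve.\<close>

lemma transfer_wronskian:
  "fst (transfer h (1, 0) n) * snd (transfer h (0, 1) n)
   - fst (transfer h (0, 1) n) * snd (transfer h (1, 0) n) = 1"
proof (induction n)
  case (Suc n)
  have "(a + h * (c - X * a)) * (d - X * b) - (b + h * (d - X * b)) * (c - X * a) = a * d - b * c"
    for a b c d X h :: "real poly"
    by (simp add: algebra_simps)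
  with Suc show ?case by (simp only: transfer_Suc)
qed simp

lemma transfer_solution:
  fixes u p :: "nat \<Rightarrow> complex" and x :: real
  assumes p: "\<And>n. n < N \<Longrightarrow> p (Suc n) = p n - of_real x * u n"
    and u: "\<And>n. n < N \<Longrightarrow> u (Suc n) = u n + of_real (h n) * p (Suc n)"
    and n: "n \<le> N"
  shows "u n = of_real (poly (fst (transfer h (1, 0) n)) x) * u 0
             + of_real (poly (fst (transfer h (0, 1) n)) x) * p 0 \<and>
         p n = of_real (poly (snd (transfer h (1, 0) n)) x) * u 0
             + of_real (poly (snd (transfer h (0, 1) n)) x) * p 0"
  using n
proof (induction n)
  case (Suc n)
  then have n: "n < N" by simp
  show ?case
    unfolding u[OF n] p[OF n] using Suc
    by (simp add: Let_def algebra_simps)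
qed simp

text \<open>The initial state is an eigenvector of the monodromy with eigenvalue \<open>m\<close>;
  the relation is the characteristic equation with determinant 1.\<close>

lemma discriminant_multiplier:
  fixes u p :: "nat \<Rightarrow> complex" and x :: real and m :: complex
  assumes p: "\<And>n. n < N \<Longrightarrow> p (Suc n) = p n - of_real x * u n"
    and u: "\<And>n. n < N \<Longrightarrow> u (Suc n) = u n + of_real (h n) * p (Suc n)"
    and per: "u N = m * u 0" "p N = m * p 0"
    and nz: "u 0 \<noteq> 0 \<or> p 0 \<noteq> 0"
  shows "m\<^sup>2 - of_real (poly (discriminant h N) x) * m + 1 = 0"
proof -
  define a b c d where abcd:
    "a = complex_of_real (poly (fst (transfer h (1, 0) N)) x)"
    "b = complex_of_real (poly (fst (transfer h (0, 1) N)) x)"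
    "c = complex_of_real (poly (snd (transfer h (1, 0) N)) x)"
    "d = complex_of_real (poly (snd (transfer h (0, 1) N)) x)"
  have "a * d - b * c = of_real (poly 1 x)"
    unfolding abcd by (subst transfer_wronskian[of h N, symmetric]) simp
  then have w: "a * d - b * c = 1" by simp
  have 1: "m * u 0 = a * u 0 + b * p 0" and 2: "m * p 0 = c * u 0 + d * p 0"
    using transfer_solution[of N p x u h N, OF p u] unfolding per abcd by auto
  \<comment> \<open>Elimination without division: the characteristic polynomial annihilates
    \<open>u 0\<close> and \<open>p 0\<close> separately, so either being nonzero suffices.\<close>
  have "(m - a) * u 0 = b * p 0" "(m - d) * p 0 = c * u 0"
    using 1 2 by (simp_all add: algebra_simps)
  then have "(m - d) * ((m - a) * u 0) = b * c * u 0" "(m - a) * ((m - d) * p 0) = b * c * p 0"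
    by simp_all
  moreover have "m\<^sup>2 - (a + d) * m + 1 = (m - d) * (m - a) - b * c"
    using w by (simp add: algebra_simps power2_eq_square)
  ultimately have "(m\<^sup>2 - (a + d) * m + 1) * u 0 = 0" "(m\<^sup>2 - (a + d) * m + 1) * p 0 = 0"
    by (simp_all only:) (simp_all add: algebra_simps)
  with nz have "m\<^sup>2 - (a + d) * m + 1 = 0" by auto
  then show ?thesis by (simp add: discriminant_def abcd)
qed

section \<open>The first three coefficients of the trace\<close>

lemma coeff_transfer_Suc:
  "coeff (snd (transfer h s (Suc n))) 0 = coeff (snd (transfer h s n)) 0"
  "coeff (snd (transfer h s (Suc n))) (Suc m) = coeff (snd (transfer h s n)) (Suc m) - coeff (fst (transfer h s n)) m"
  "coeff (fst (transfer h s (Suc n))) m = coeff (fst (transfer h s n)) m + h n * coeff (snd (transfer h s (Suc n))) m"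
  by (simp_all add: Let_def coeff_pCons)

text \<open>The weight at \<open>i = n\<close> vanishes in the longer sum, so passing to
  \<open>Suc n\<close> only raises the other weights by one, as the force recursion does.\<close>

lemma sum_ramp_Suc:
  fixes w :: "nat \<Rightarrow> real"
  shows "(\<Sum>i<Suc n. w i * (real (Suc n) - 1 - real i)) = (\<Sum>i<n. w i * (real n - 1 - real i)) + (\<Sum>i<n. w i)"
  by (simp add: algebra_simps flip: sum.distrib sum_subtractf)

lemma sum_ramp_Suc':
  fixes w :: "nat \<Rightarrow> real"
  shows "(\<Sum>i<Suc n. w i * (real (Suc n) - 1 - real i)) = (\<Sum>i<n. w i * (real n - real i))"
  by simp

text \<open>The force entries lie outside the trace but are carried along, because the recursion
  couples them to the displacement.\<close>

lemma coeff_transfer_1_0: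
  "coeff (snd (transfer h (1, 0) n)) 0 = 0 \<and> coeff (fst (transfer h (1, 0) n)) 0 = 1
    \<and> coeff (snd (transfer h (1, 0) n)) (Suc 0) = - real n
    \<and> coeff (fst (transfer h (1, 0) n)) (Suc 0) = - (\<Sum>i<n. h i * (real i + 1))
    \<and> coeff (snd (transfer h (1, 0) n)) (Suc (Suc 0)) = (\<Sum>i<n. h i * (real i + 1) * (real n - 1 - real i))
    \<and> coeff (fst (transfer h (1, 0) n)) (Suc (Suc 0)) = (\<Sum>j<n. h j * (\<Sum>i<j. h i * (real i + 1) * (real j - real i)))"
proof (induction n)
  case (Suc n)
  \<comment> \<open>Force first: the displacement coefficient at \<open>Suc n\<close> depends on the
    force coefficient at \<open>Suc n\<close>.\<close>
  have c1: "coeff (snd (transfer h (1, 0) (Suc n))) (Suc 0) = - real (Suc n)"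
    using Suc by (simp add: coeff_transfer_Suc del: transfer.simps)
  have c2: "coeff (snd (transfer h (1, 0) (Suc n))) (Suc (Suc 0))
      = (\<Sum>i<Suc n. h i * (real i + 1) * (real (Suc n) - 1 - real i))"
    using Suc unfolding sum_ramp_Suc coeff_transfer_Suc by (simp del: transfer.simps)
  show ?case
    using Suc by (intro conjI c1 c2)
      (simp_all only: coeff_transfer_Suc(3) c1 c2 sum_ramp_Suc', simp_all add: coeff_transfer_Suc(1) algebra_simps del: transfer.simps)
qed simp

lemma coeff_transfer_0_1:
  "coeff (snd (transfer h (0, 1) n)) 0 = 1 \<and> coeff (fst (transfer h (0, 1) n)) 0 = (\<Sum>i<n. h i)
    \<and> coeff (snd (transfer h (0, 1) n)) (Suc 0) = - (\<Sum>i<n. h i * (real n - 1 - real i))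
    \<and> coeff (fst (transfer h (0, 1) n)) (Suc 0) = - (\<Sum>j<n. h j * (\<Sum>i<j. h i * (real j - real i)))
    \<and> coeff (snd (transfer h (0, 1) n)) (Suc (Suc 0))
        = (\<Sum>j<n. h j * (\<Sum>i<j. h i * (real j - real i)) * (real n - 1 - real j))"
proof (induction n)
  case (Suc n)
  have d1: "coeff (snd (transfer h (0, 1) (Suc n))) (Suc 0)
      = - (\<Sum>i<Suc n. h i * (real (Suc n) - 1 - real i))"
    using Suc unfolding sum_ramp_Suc coeff_transfer_Suc by (simp del: transfer.simps)
  have d2: "coeff (snd (transfer h (0, 1) (Suc n))) (Suc (Suc 0))
      = (\<Sum>j<Suc n. h j * (\<Sum>i<j. h i * (real j - real i)) * (real (Suc n) - 1 - real j))"
    using Suc unfolding sum_ramp_Suc coeff_transfer_Suc by (simp del: transfer.simps)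
  show ?case
    using Suc by (intro conjI d1 d2)
      (simp_all only: coeff_transfer_Suc(3) d1 d2 sum_ramp_Suc', simp_all add: coeff_transfer_Suc(1) del: transfer.simps)
qed simp

text \<open>In first order the weights \<open>i + 1\<close> and \<open>n - 1 - i\<close> add up to
  \<open>n\<close>; in second order \<open>(i + 1) * (j - i)\<close> and
  \<open>(j - i) * (n - 1 - j)\<close> add up to \<open>c_coeff n i j\<close>.\<close>

lemma coeff_discriminant:
  "coeff (discriminant h n) 0 = 2"
  "coeff (discriminant h n) (Suc 0) = - (real n * (\<Sum>i<n. h i))"
  "coeff (discriminant h n) (Suc (Suc 0)) = (\<Sum>j<n. \<Sum>i<j. c_coeff n i j * h i * h j)"
proof -
  show "coeff (discriminant h n) 0 = 2"
    by (simp add: discriminant_def coeff_transfer_1_0 coeff_transfer_0_1)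
  show "coeff (discriminant h n) (Suc 0) = - (real n * (\<Sum>i<n. h i))"
    by (simp add: discriminant_def coeff_transfer_1_0 coeff_transfer_0_1 sum_distrib_left
        flip: sum.distrib sum_negf) (simp add: algebra_simps)
  have "(\<Sum>j<n. h j * (\<Sum>i<j. h i * (real i + 1) * (real j - real i)))
      + (\<Sum>j<n. h j * (\<Sum>i<j. h i * (real j - real i)) * (real n - 1 - real j))
      = (\<Sum>j<n. \<Sum>i<j. c_coeff n i j * h i * h j)"
    unfolding sum.distrib[symmetric] sum_distrib_left sum_distrib_right
    by (intro sum.cong refl) (simp add: c_coeff_def algebra_simps)
  then show "coeff (discriminant h n) (Suc (Suc 0)) = (\<Sum>j<n. \<Sum>i<j. c_coeff n i j * h i * h j)"
    by (simp add: discriminant_def coeff_transfer_1_0 coeff_transfer_0_1)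
qed

text \<open>The eigenvalue will be of order k^2, so everything from the cubic term on is O(k^6) and
  is packed into \<open>r\<close>.\<close>

lemma poly_discriminant:
  obtains r where "\<And>x. poly (discriminant h n) x =
    2 - real n * (\<Sum>i<n. h i) * x + (\<Sum>j<n. \<Sum>i<j. c_coeff n i j * h i * h j) * x^2 + x^3 * poly r x"
proof -
  obtain c0 c1 c2 r where f: "discriminant h n = pCons c0 (pCons c1 (pCons c2 r))"
    by (metis pCons_cases)
  have "c0 = 2" "c1 = - (real n * (\<Sum>i<n. h i))" "c2 = (\<Sum>j<n. \<Sum>i<j. c_coeff n i j * h i * h j)"
    using coeff_discriminant[of h n] unfolding f
    by (simp_all add: coeff_pCons)
  with f show thesis
    by (intro that[of r]) (simp add: algebra_simps power2_eq_square power3_eq_cube)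
qed

section \<open>Bloch waves and the energy form\<close>

text \<open>The value at \<open>n = N\<close> continues the wave into the next cell, with the
  multiplier dictated by the corner phases of the matrix. Only \<open>n \<le> N\<close> is
  meaningful.\<close>

definition bloch_ext :: "nat \<Rightarrow> real \<Rightarrow> (nat \<Rightarrow> complex) \<Rightarrow> nat \<Rightarrow> complex" where
  "bloch_ext N t v n = (if n < N then v n else cis (- t) * v 0)"

text \<open>Index \<open>n\<close> is the bond ending at site \<open>n\<close>. At 0 this is the
  closing bond, with \<open>cis t * v (N - 1)\<close> as the value just before site 0.\<close>

definition bloch_flux :: "nat \<Rightarrow> (nat \<Rightarrow> real) \<Rightarrow> real \<Rightarrow> (nat \<Rightarrow> complex) \<Rightarrow> nat \<Rightarrow> complex" where
  "bloch_flux N g t v n = (case n of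
     0 \<Rightarrow> of_real (g (N - 1)) * (v 0 - cis t * v (N - 1))
   | Suc m \<Rightarrow> of_real (g m) * (bloch_ext N t v (Suc m) - bloch_ext N t v m))"

lemma bloch_ext_period:
  "N > 0 \<Longrightarrow> bloch_ext N t v N = cis (- t) * bloch_ext N t v 0"
  by (simp add: bloch_ext_def)

lemma bloch_flux_period:
  assumes "N > 0"
  shows "bloch_flux N g t v N = cis (- t) * bloch_flux N g t v 0"
proof -
  from assms obtain m where N: "N = Suc m" by (cases N) auto
  have "cis (- t) * (cis t * v m) = v m"
    by (simp add: cis_mult flip: mult.assoc)
  then have "cis (- t) * (of_real (g m) * (v 0 - cis t * v m)) = of_real (g m) * (cis (- t) * v 0 - v m)"
    by (simp add: right_diff_distrib mult.left_commute[of "cis (- t)"])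
  then show ?thesis
    by (auto simp: N bloch_flux_def bloch_ext_def)
qed

text \<open>The Bloch continuation supplies exactly the corner phases, so every row, the first and
  last included, becomes a difference of bond forces.\<close>

lemma dyn_matrix_apply:
  assumes N: "N \<ge> 3" and n: "n < N"
  shows "(\<Sum>j<N. dyn_matrix N g L k $$ (n, j) * v j)
       = bloch_flux N g (k * L) v n - bloch_flux N g (k * L) v (Suc n)"
proof -
  define t where "t = k * L"
  define prev where "prev = (if n = 0 then N - 1 else n - 1)"
  define nxt where "nxt = (if n = N - 1 then 0 else n + 1)"
  define A where "A = - (of_real (g prev) * (if n = 0 then cis t else 1))"
  define C where "C = - (of_real (g n) * (if n = N - 1 then cis (- t) else 1))"
  \<comment> \<open>\<open>N \<ge> 3\<close> keeps the two cyclic neighbours distinct, so the row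
    sum splits into three point contributions.\<close>
  have lt: "prev < N" "nxt < N" and ne: "prev \<noteq> n" "nxt \<noteq> n" "prev \<noteq> nxt"
    using N n by (auto simp: prev_def nxt_def split: if_splits)
  have entry: "dyn_matrix N g L k $$ (n, j) =
      (if j = n then of_real (g prev + g n) else if j = nxt then C else if j = prev then A else 0)"
    if j: "j < N" for j
  proof -
    consider "n = 0" | "n \<noteq> 0" "n = N - 1" | m where "n = Suc m" "Suc n < N"
      using n by (cases n) force+
    then show ?thesis
    proof cases
      case 1
      then show ?thesis
        using j N by (auto simp: dyn_matrix_def A_def C_def prev_def nxt_def t_def)
    next
      case 2
      then have "N = Suc n" "n \<ge> 2" using N n by auto
      then show ?thesis
        using j by (auto simp: dyn_matrix_def A_def C_def prev_def nxt_def t_def)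
    next
      case 3
      then show ?thesis
        using j n by (auto simp: dyn_matrix_def A_def C_def prev_def nxt_def)
    qed
  qed
  have "dyn_matrix N g L k $$ (n, j) * v j =
      (if j = n then of_real (g prev + g n) * v n else 0)
      + (if j = nxt then C * v nxt else 0) + (if j = prev then A * v prev else 0)" if "j < N" for j
    using ne unfolding entry[OF that] by auto
  then have "(\<Sum>j<N. dyn_matrix N g L k $$ (n, j) * v j)
      = of_real (g prev + g n) * v n + C * v nxt + A * v prev"
    using lt n by (simp add: sum.distrib)
  also have "\<dots> = bloch_flux N g t v n - bloch_flux N g t v (Suc n)"
  proof (cases n)
    case 0
    then show ?thesis using N
      by (simp add: bloch_flux_def bloch_ext_def A_def C_def prev_def nxt_def algebra_simps)
  next
    case (Suc m)
    then show ?thesis using N n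
      by (auto simp: bloch_flux_def bloch_ext_def A_def C_def prev_def nxt_def algebra_simps)
  qed
  finally show ?thesis by (simp add: t_def)
qed

section \<open>The elastic energy and a discrete Poincare inequality\<close>

definition bloch_energy :: "nat \<Rightarrow> (nat \<Rightarrow> real) \<Rightarrow> real \<Rightarrow> (nat \<Rightarrow> complex) \<Rightarrow> real" where
  "bloch_energy N g t v = (\<Sum>n<N. g n * (cmod (bloch_ext N t v (Suc n) - bloch_ext N t v n))\<^sup>2)"

text \<open>Summation by parts. The boundary terms cancel, since displacement and force share a
  multiplier of modulus 1 and one of them is conjugated.\<close>

lemma dyn_matrix_energy:
  assumes N: "N \<ge> 3"
  shows "(\<Sum>n<N. cnj (v n) * (\<Sum>j<N. dyn_matrix N g L k $$ (n, j) * v j))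
       = of_real (bloch_energy N g (k * L) v)"
proof -
  define u where "u = bloch_ext N (k * L) v"
  define p where "p = bloch_flux N g (k * L) v"
  have abel: "(\<Sum>n<m. cnj (u n) * (p n - p (Suc n)))
      = cnj (u 0) * p 0 - cnj (u m) * p m + (\<Sum>n<m. cnj (u (Suc n) - u n) * p (Suc n))" for m
    by (induction m) (simp_all add: algebra_simps)
  have "cnj (u N) * p N = cnj (u 0) * p 0"
  proof -
    have "cnj (u N) * p N = (cnj (cis (- (k * L))) * cis (- (k * L))) * (cnj (u 0) * p 0)"
      using N by (simp add: u_def p_def bloch_ext_period bloch_flux_period mult_ac)
    then show ?thesis by (simp add: cis_cnj cis_mult)
  qed
  with abel[of N] have "(\<Sum>n<N. cnj (u n) * (p n - p (Suc n)))
      = (\<Sum>n<N. cnj (u (Suc n) - u n) * p (Suc n))"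
    by simp
  also have "\<dots> = (\<Sum>n<N. of_real (g n * (cmod (u (Suc n) - u n))\<^sup>2))"
    by (intro sum.cong) (simp_all add: p_def bloch_flux_def complex_norm_square u_def
        del: of_real_power)
  finally have "(\<Sum>n<N. cnj (u n) * (p n - p (Suc n))) = of_real (bloch_energy N g (k * L) v)"
    by (simp add: bloch_energy_def u_def)
  moreover have "(\<Sum>n<N. cnj (v n) * (\<Sum>j<N. dyn_matrix N g L k $$ (n, j) * v j))
      = (\<Sum>n<N. cnj (u n) * (p n - p (Suc n)))"
    using N by (intro sum.cong) (simp_all add: dyn_matrix_apply u_def p_def bloch_ext_def)
  ultimately show ?thesis by simp
qed

lemma bloch_energy_nonneg:
  "(\<And>n. n < N \<Longrightarrow> g n > 0) \<Longrightarrow> bloch_energy N g t v \<ge> 0"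
  unfolding bloch_energy_def by (intro sum_nonneg) (simp add: less_imp_le)

text \<open>From the zero at site 0 each value telescopes into bond differences, each at most
  \<open>sqrt (E / g n)\<close>. The constant is free of \<open>t\<close>, hence uniform in
  k.\<close>

lemma bloch_poincare:
  assumes g: "\<And>n. n < N \<Longrightarrow> g n > 0" and v0: "v 0 = 0"
  shows "(\<Sum>n<N. (cmod (v n))\<^sup>2) \<le> real N * (\<Sum>n<N. 1 / sqrt (g n))\<^sup>2 * bloch_energy N g t v"
proof -
  define u where "u = bloch_ext N t v"
  define E where "E = bloch_energy N g t v"
  define K where "K = (\<Sum>n<N. 1 / sqrt (g n))"
  have E0: "E \<ge> 0" unfolding E_def by (rule bloch_energy_nonneg[OF g])
  have step: "cmod (u (Suc n) - u n) \<le> sqrt E * (1 / sqrt (g n))" if n: "n < N" for n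
  proof -
    have "g n * (cmod (u (Suc n) - u n))\<^sup>2 \<le> E"
      unfolding E_def bloch_energy_def u_def using n g
      by (intro member_le_sum) (simp_all add: less_imp_le)
    then have "sqrt (g n * (cmod (u (Suc n) - u n))\<^sup>2) \<le> sqrt E" by simp
    then show ?thesis using g[OF n] by (simp add: real_sqrt_mult field_simps)
  qed
  have "cmod (v n) \<le> sqrt E * K" if n: "n < N" for n
  proof -
    have "u 0 = 0" using n v0 by (simp add: u_def bloch_ext_def)
    then have "v n = (\<Sum>m<n. u (Suc m) - u m)"
      using n by (simp add: sum_lessThan_telescope u_def bloch_ext_def)
    also have "cmod \<dots> \<le> (\<Sum>m<n. sqrt E * (1 / sqrt (g m)))"
      using n by (intro sum_norm_le step) auto
    also have "\<dots> \<le> (\<Sum>m<N. sqrt E * (1 / sqrt (g m)))"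
      using n E0 g by (intro sum_mono2) (auto simp: less_imp_le)
    finally show ?thesis by (simp add: K_def sum_distrib_left)
  qed
  then have "(\<Sum>n<N. (cmod (v n))\<^sup>2) \<le> (\<Sum>n<N. (sqrt E * K)\<^sup>2)"
    by (intro sum_mono power_mono) auto
  then show ?thesis
    using E0 by (simp add: power_mult_distrib K_def E_def mult_ac)
qed

text \<open>Multiplying by the inverse multiplier \<open>cis t\<close> turns the equation into
  \<open>f = cis (- t) + cis t\<close>.\<close>

lemma cis_root_cos:
  assumes "(cis (- t))\<^sup>2 - of_real f * cis (- t) + 1 = 0"
  shows "f = 2 * cos t"
proof -
  have "cis t * ((cis (- t))\<^sup>2 - of_real f * cis (- t) + 1) = cis (- t) + cis t - of_real f"
    by (simp add: ring_distribs power2_eq_square mult.left_commute[of "cis t"] cis_mult)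
  with assms have "of_real f = cis (- t) + cis t" by simp
  then have "Re (of_real f) = Re (cis (- t) + cis t)" by (simp only:)
  then show ?thesis by simp
qed

section \<open>Eigenvalues of Hermitian matrices\<close>

text \<open>In a Schur form with increasing diagonal the first two columns of \<open>P\<close> span
  an invariant plane. Gram-Schmidt inside it gives orthogonality even for a double
  eigenvalue.\<close>

lemma hermitian_two_eigenvectors:
  fixes A :: "complex mat"
  assumes A: "A \<in> carrier_mat n n" and herm: "mat_adjoint A = A" and n: "n \<ge> 2"
  obtains p q where
    "\<And>i. i < n \<Longrightarrow> (\<Sum>j<n. A $$ (i, j) * p j) = of_real (sorted_eigenvalues A ! 0) * p i"
    "\<And>i. i < n \<Longrightarrow> (\<Sum>j<n. A $$ (i, j) * q j) = of_real (sorted_eigenvalues A ! 1) * q i"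
    "(\<Sum>i<n. cnj (p i) * q i) = 0" "\<exists>i<n. p i \<noteq> 0" "\<exists>i<n. q i \<noteq> 0"
proof -
  define es where "es = map complex_of_real (sorted_eigenvalues A)"
  obtain B P Q where S: "schur_decomposition A es = (B, P, Q)" by (metis prod_cases3)
  have "char_poly A = (\<Prod>e\<leftarrow>es. [:- e, 1:])"
    using char_poly_sorted_eigenvalues[OF A herm] by (simp add: es_def o_def)
  from schur_decomposition[OF A this S] have sim: "similar_mat_wit A B P Q"
    and ut: "upper_triangular B" and diag: "diag_mat B = es" by auto
  note w = similar_mat_witD2[OF A sim]
  have len: "length (sorted_eigenvalues A) = n" by (rule length_sorted_eigenvalues[OF A])
  define e where "e i = sorted_eigenvalues A ! i" for i
  have Bdiag: "B $$ (i, i) = of_real (e i)" if "i < n" for i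
  proof -
    have "diag_mat B ! i = B $$ (i, i)" using that w(5) by (simp add: diag_mat_def)
    with diag that len show ?thesis by (simp add: es_def e_def)
  qed
  have "A * P = P * B * (Q * P)"
    using w(3) assoc_mult_mat[OF mult_carrier_mat[OF w(6,5)] w(7,6)] by simp
  then have AP: "A * P = P * B" using w(2) right_mult_one_mat[OF mult_carrier_mat[OF w(6,5)]] by simp
  have col: "(\<Sum>j<n. A $$ (i, j) * P $$ (j, m)) = (\<Sum>j<n. P $$ (i, j) * B $$ (j, m))"
    if "i < n" "m < n" for i m
  proof -
    have "(A * P) $$ (i, m) = (\<Sum>j<n. A $$ (i, j) * P $$ (j, m))"
      using that w A by (simp add: scalar_prod_def atLeast0LessThan)
    moreover have "(P * B) $$ (i, m) = (\<Sum>j<n. P $$ (i, j) * B $$ (j, m))"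
      using that w by (simp add: scalar_prod_def atLeast0LessThan)
    ultimately show ?thesis using AP by simp
  qed
  have QP: "(\<Sum>j<n. Q $$ (i, j) * P $$ (j, m)) = (if i = m then 1 else 0)" if "i < n" "m < n" for i m
  proof -
    have "(Q * P) $$ (i, m) = (\<Sum>j<n. Q $$ (i, j) * P $$ (j, m))"
      using that w(6,7) by (simp add: scalar_prod_def atLeast0LessThan)
    then show ?thesis using that by (simp add: w(2))
  qed
  define p r where "p i = P $$ (i, 0)" and "r i = P $$ (i, 1)" for i
  define b where "b = B $$ (0, 1)"
  have Ap: "(\<Sum>j<n. A $$ (i, j) * p j) = of_real (e 0) * p i" if "i < n" for i
  proof -
    have "(\<Sum>j<n. P $$ (i, j) * B $$ (j, 0)) = (\<Sum>j<n. if j = 0 then P $$ (i, 0) * B $$ (0, 0) else 0)"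
      using ut w(5) by (intro sum.cong) (auto simp: upper_triangular_def)
    then show ?thesis
      using col[OF that, of 0] n Bdiag[of 0] by (simp add: p_def)
  qed
  have Ar: "(\<Sum>j<n. A $$ (i, j) * r j) = b * p i + of_real (e 1) * r i" if "i < n" for i
  proof -
    have "(\<Sum>j<n. P $$ (i, j) * B $$ (j, 1)) =
       (\<Sum>j<n. (if j = 0 then P $$ (i, 0) * B $$ (0, 1) else 0) + (if j = 1 then P $$ (i, 1) * B $$ (1, 1) else 0))"
      using ut w(5) by (intro sum.cong) (auto simp: upper_triangular_def)
    then show ?thesis
      using col[OF that, of 1] n Bdiag[of 1] by (simp add: p_def r_def b_def sum.distrib)
  qed
  have p_nz: "\<exists>i<n. p i \<noteq> 0"
  proof (rule ccontr)
    assume "\<not> ?thesis"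
    then have "(\<Sum>j<n. Q $$ (0, j) * p j) = 0" by simp
    then show False using QP[of 0 0] n by (simp add: p_def)
  qed
  define s where "s = (\<Sum>i<n. cnj (p i) * p i)"
  have "s = of_real (\<Sum>i<n. (cmod (p i))\<^sup>2)"
    by (simp add: s_def complex_norm_square mult_ac del: of_real_power)
  moreover have "(\<Sum>i<n. (cmod (p i))\<^sup>2) \<noteq> 0"
    using p_nz by (auto simp: sum_nonneg_eq_0_iff)
  ultimately have s: "s \<noteq> 0" by (simp only: of_real_eq_0_iff not_False_eq_True)
  \<comment> \<open>\<open>c\<close> removes the component of \<open>r\<close> along
    \<open>p\<close>; \<open>d\<close> is the coefficient of \<open>p\<close> in the image of
    \<open>q\<close>.\<close>
  define c where "c = (\<Sum>i<n. cnj (p i) * r i) / s"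
  define q where "q i = r i - c * p i" for i
  define d where "d = b + c * (of_real (e 1) - of_real (e 0))"
  have orth: "(\<Sum>i<n. cnj (p i) * q i) = 0"
  proof -
    have "(\<Sum>i<n. cnj (p i) * q i) = (\<Sum>i<n. cnj (p i) * r i) - c * s"
      by (simp add: q_def s_def algebra_simps sum_subtractf sum_distrib_left)
    with s show ?thesis by (simp add: c_def)
  qed
  have Aq: "(\<Sum>j<n. A $$ (i, j) * q j) = d * p i + of_real (e 1) * q i" if "i < n" for i
  proof -
    have "(\<Sum>j<n. A $$ (i, j) * q j) = (\<Sum>j<n. A $$ (i, j) * r j) - c * (\<Sum>j<n. A $$ (i, j) * p j)"
      by (simp add: q_def algebra_simps sum_subtractf sum_distrib_left)
    then show ?thesis
      unfolding Ap[OF that] Ar[OF that] by (simp add: q_def d_def algebra_simps)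
  qed
  have sym: "cnj (A $$ (i, j)) = A $$ (j, i)" if "i < n" "j < n" for i j
  proof -
    have "A $$ (j, i) = mat_adjoint A $$ (j, i)" by (simp add: herm)
    also have "\<dots> = cnj (A $$ (i, j))"
      using A that by (simp add: mat_adjoint_def mat_of_rows_def)
    finally show ?thesis by simp
  qed
  \<comment> \<open>Self-adjointness makes \<open>p\<close>'s orthogonal complement invariant, so the Jordan-type term \<open>d\<close> vanishes.\<close>
  have "d * s = (\<Sum>i<n. cnj (p i) * (\<Sum>j<n. A $$ (i, j) * q j))"
  proof -
    have "(\<Sum>i<n. cnj (p i) * (\<Sum>j<n. A $$ (i, j) * q j))
        = (\<Sum>i<n. d * (cnj (p i) * p i) + of_real (e 1) * (cnj (p i) * q i))"
      by (intro sum.cong refl) (simp only: Aq lessThan_iff, simp add: algebra_simps)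
    also have "\<dots> = d * s + of_real (e 1) * (\<Sum>i<n. cnj (p i) * q i)"
      by (simp add: sum.distrib s_def sum_distrib_left)
    finally show ?thesis by (simp add: orth)
  qed
  also have "\<dots> = (\<Sum>j<n. \<Sum>i<n. cnj (p i) * (A $$ (i, j) * q j))"
    by (simp add: sum_distrib_left) (rule sum.swap)
  also have "\<dots> = (\<Sum>j<n. cnj (\<Sum>i<n. A $$ (j, i) * p i) * q j)"
    unfolding cnj_sum sum_distrib_right by (intro sum.cong) (auto simp: sym)
  also have "\<dots> = of_real (e 0) * (\<Sum>j<n. cnj (p j) * q j)"
    unfolding sum_distrib_left
    by (intro sum.cong refl)
      (simp only: Ap lessThan_iff complex_cnj_mult complex_cnj_complex_of_real mult.assoc)
  finally have "d = 0" using s by (simp add: orth)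
  \<comment> \<open>Row 1 of \<open>Q\<close> annihilates \<open>p\<close> and sends
    \<open>r\<close> to 1, hence also \<open>q\<close> to 1.\<close>
  have q_nz: "\<exists>i<n. q i \<noteq> 0"
  proof (rule ccontr)
    assume "\<not> ?thesis"
    then have "(\<Sum>j<n. Q $$ (1, j) * q j) = 0" by simp
    moreover have "(\<Sum>j<n. Q $$ (1, j) * q j) = (\<Sum>j<n. Q $$ (1, j) * r j) - c * (\<Sum>j<n. Q $$ (1, j) * p j)"
      by (simp add: q_def algebra_simps sum_subtractf sum_distrib_left)
    ultimately show False using QP[of 1 1] QP[of 1 0] n by (simp add: p_def r_def)
  qed
  from Ap Aq \<open>d = 0\<close> orth p_nz q_nz show thesis
    by (intro that[of p q]) (simp_all add: e_def)
qed

lemma sorted_eigenvalues_det: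
  fixes A :: "complex mat"
  assumes A: "A \<in> carrier_mat n n" and herm: "mat_adjoint A = A"
  shows "det A = of_real (\<Prod>i<n. sorted_eigenvalues A ! i)"
proof -
  define es where "es = map complex_of_real (sorted_eigenvalues A)"
  obtain B P Q where S: "schur_decomposition A es = (B, P, Q)" by (metis prod_cases3)
  have "char_poly A = (\<Prod>e\<leftarrow>es. [:- e, 1:])"
    using char_poly_sorted_eigenvalues[OF A herm] by (simp add: es_def o_def)
  from schur_decomposition[OF A this S] have sim: "similar_mat_wit A B P Q"
    and ut: "upper_triangular B" and diag: "diag_mat B = es" by auto
  have "det A = det B" using sim by (intro det_similar) (auto simp: similar_mat_def)
  also have "\<dots> = prod_list es"
    using det_upper_triangular[OF ut] similar_mat_witD2[OF A sim] diag by auto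
  also have "\<dots> = of_real (\<Prod>i<n. sorted_eigenvalues A ! i)"
    by (simp add: es_def prod.list_conv_set_nth length_sorted_eigenvalues[OF A] atLeast0LessThan
        flip: of_real_prod)
  finally show ?thesis .
qed

lemma sorted_eigenvalues_mono:
  assumes "A \<in> carrier_mat n n" "i \<le> j" "j < n"
  shows "sorted_eigenvalues A ! i \<le> sorted_eigenvalues A ! j"
  using assms length_sorted_eigenvalues[OF assms(1)]
  by (intro sorted_nth_mono) (simp_all add: sorted_eigenvalues_def)

section \<open>Inverting the dispersion relation\<close>

text \<open>The fifth-order coefficient vanishes, so the remainder is of order six;
  \<open>360\<close> is half of \<open>fact 6\<close>.\<close>

lemma cos_taylor_bound:
  fixes x :: real
  shows "\<bar>2 - 2 * cos x - x^2 + x^4 / 12\<bar> \<le> \<bar>x\<bar>^6 / 360"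
proof -
  obtain t where t: "cos x = (\<Sum>m<6. cos_coeff m * x ^ m) + cos (t + 1/2 * real 6 * pi) / fact 6 * x ^ 6"
    using Maclaurin_cos_expansion[of x 6] by blast
  have "cos x = 1 - x^2 / 2 + x^4 / 24 + cos (t + 1/2 * real 6 * pi) / fact 6 * x ^ 6"
  proof -
    have "(\<Sum>m<6. f m) = f 0 + f 1 + f 2 + f 3 + f 4 + f 5" for f :: "nat \<Rightarrow> real"
      by (simp add: numeral_eq_Suc)
    then show ?thesis
      unfolding t by (simp add: cos_coeff_def fact_numeral)
  qed
  then have "2 - 2 * cos x - x^2 + x^4 / 12 = - (cos (t + 1/2 * real 6 * pi)) * (x ^ 6 / 360)"
    by (simp add: fact_numeral)
  then have "\<bar>2 - 2 * cos x - x^2 + x^4 / 12\<bar> = \<bar>cos (t + 1/2 * real 6 * pi)\<bar> * (\<bar>x\<bar>^6 / 360)"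
    by (simp only: abs_mult abs_minus_cancel abs_divide power_abs)
  also have "\<dots> \<le> 1 * (\<bar>x\<bar>^6 / 360)"
    by (intro mult_right_mono) auto
  finally show ?thesis by simp
qed

text \<open>Bootstrapping: smallness of \<open>w\<close> gives \<open>w = O(k^2)\<close>, the
  relation then improves this to the leading term up to O(k^4), and reinserting that in the
  quadratic term leaves O(k^6).\<close>

lemma implicit_dispersion_expansion:
  fixes w :: "real \<Rightarrow> real" and a S L :: real and r :: "real poly"
  assumes a: "a > 0" and L: "L > 0" and w0: "(w \<longlongrightarrow> 0) (at 0)"
    and eq: "\<And>k. 2 * cos (k * L) = 2 - a * w k + S * (w k)^2 + (w k)^3 * poly r (w k)"
  shows "(\<lambda>k. w k - (L^2 / a * k^2 + (S * L^4 / a^3 - L^4 / (12 * a)) * k^4)) \<in> O[at 0](\<lambda>k. k^6)"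
proof -
  define R where "R k = poly r (w k)" for k
  define E where "E k = 2 - 2 * cos (k * L) - (k * L)^2 + (k * L)^4 / 12" for k
  have E: "E \<in> O[at 0](\<lambda>k. k^6)"
  proof (rule bigoI)
    show "\<forall>\<^sub>F k in at 0. norm (E k) \<le> L^6 / 360 * norm (k^6)"
    proof (intro always_eventually allI)
      fix k
      show "norm (E k) \<le> L^6 / 360 * norm (k^6)"
        using cos_taylor_bound[of "k * L"] L
        by (simp add: E_def power_mult_distrib abs_mult power_abs mult.commute)
    qed
  qed
  have C: "(\<lambda>k. 2 - 2 * cos (k * L)) \<in> O[at 0](\<lambda>k. k^2)"
  proof (rule bigoI)
    show "\<forall>\<^sub>F k in at 0. norm (2 - 2 * cos (k * L)) \<le> L^2 * norm (k^2)"
    proof (intro always_eventually allI)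
      fix k :: real
      have "\<bar>sin (k * L / 2)\<bar>^2 \<le> \<bar>k * L / 2\<bar>^2" by (intro power_mono abs_sin_x_le_abs_x) simp
      then show "norm (2 - 2 * cos (k * L)) \<le> L^2 * norm (k^2)"
        using cos_double_sin[of "k * L / 2"] by (simp add: power_mult_distrib power_divide mult.commute)
    qed
  qed
  have R: "(R \<longlongrightarrow> poly r 0) (at 0)"
    unfolding R_def using w0 by (rule tendsto_poly)
  \<comment> \<open>The nonlinear part of the relation is \<open>w k\<close> times this factor; once
    the factor is below \<open>a / 2\<close>, half of the linear term absorbs it.\<close>
  have small: "((\<lambda>k. S * w k + (w k)^2 * R k) \<longlongrightarrow> S * 0 + 0^2 * poly r 0) (at 0)"
    by (intro tendsto_intros w0 R)
  then have "\<forall>\<^sub>F k in at 0. norm (S * w k + (w k)^2 * R k) < a / 2"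
    using a by (intro order_tendstoD(2)[OF tendsto_norm_zero]) simp_all
  then have "\<forall>\<^sub>F k in at 0. norm (w k) \<le> 2 / a * norm (2 - 2 * cos (k * L))"
  proof eventually_elim
    case (elim k)
    have "a * w k = (2 - 2 * cos (k * L)) + (S * w k + (w k)^2 * R k) * w k"
      using eq[of k] by (simp add: R_def algebra_simps power2_eq_square power3_eq_cube)
    then have "\<bar>a * w k\<bar> \<le> \<bar>2 - 2 * cos (k * L)\<bar> + \<bar>(S * w k + (w k)^2 * R k) * w k\<bar>"
      by (simp only: abs_triangle_ineq)
    also have "\<bar>(S * w k + (w k)^2 * R k) * w k\<bar> \<le> a / 2 * \<bar>w k\<bar>"
      unfolding abs_mult using elim by (intro mult_right_mono) auto
    finally have "a * \<bar>w k\<bar> \<le> 2 * \<bar>2 - 2 * cos (k * L)\<bar>"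
      using a by (simp add: abs_mult)
    then show ?case using a by (simp add: field_simps)
  qed
  then have "w \<in> O[at 0](\<lambda>k. 2 - 2 * cos (k * L))" by (rule bigoI)
  then have w: "w \<in> O[at 0](\<lambda>k. k^2)" using C by (rule landau_o.big_trans)
  have "(\<lambda>k. (w k)^2) \<in> O[at 0](\<lambda>k. (k^2)^2)" "(\<lambda>k. (w k)^3) \<in> O[at 0](\<lambda>k. (k^2)^3)"
    by (intro landau_o.big_power w)+
  then have w2: "(\<lambda>k. (w k)^2) \<in> O[at 0](\<lambda>k. k^4)" and w3: "(\<lambda>k. (w k)^3) \<in> O[at 0](\<lambda>k. k^6)"
    by (simp_all flip: power_mult)
  have "R \<in> O[at 0](\<lambda>_. 1)"
    using R by (intro bigoI_tendsto[where c = "poly r 0"]) simp_all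
  with w3 have w3R: "(\<lambda>k. (w k)^3 * R k) \<in> O[at 0](\<lambda>k. k^6)"
    using landau_o.big.mult by fastforce
  have k64: "(\<lambda>k. k^6) \<in> O[at 0](\<lambda>k::real. k^4)" by real_asymp
  have cmult: "(\<lambda>k. c * f k) \<in> O[at 0](h)" if "f \<in> O[at 0](h)" for c and f h :: "real \<Rightarrow> real"
    using that by (cases "c = 0") simp_all
  define d where "d k = w k - L^2 / a * k^2" for k
  have aw: "a * w k = E k + (k * L)^2 - (k * L)^4 / 12 + S * (w k)^2 + (w k)^3 * R k" for k
    using eq[of k] by (simp add: E_def R_def)
  have "d = (\<lambda>k. 1 / a * (E k - (L^4 / 12) * k^4 + S * (w k)^2 + (w k)^3 * R k))"
  proof
    fix k
    have "a * d k = E k - (L^4 / 12) * k^4 + S * (w k)^2 + (w k)^3 * R k"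
      using a aw[of k] by (simp add: d_def right_diff_distrib power_mult_distrib)
    then show "d k = 1 / a * (E k - (L^4 / 12) * k^4 + S * (w k)^2 + (w k)^3 * R k)"
      using a by (simp add: eq_divide_eq mult.commute)
  qed
  also have "\<dots> \<in> O[at 0](\<lambda>k. k^4)"
    using landau_o.big_trans[OF E k64] landau_o.big_trans[OF w3R k64] w2
    by (intro cmult sum_in_bigo) simp_all
  finally have d: "d \<in> O[at 0](\<lambda>k. k^4)" .
  \<comment> \<open>Difference of squares: the product is \<open>(w k)^2\<close> minus the square of
    the leading term.\<close>
  have "(\<lambda>k. d k * (w k + L^2 / a * k^2)) \<in> O[at 0](\<lambda>k. k^4 * k^2)"
    by (intro landau_o.big.mult d sum_in_bigo w cmult landau_o.big_refl)
  then have dd: "(\<lambda>k. d k * (w k + L^2 / a * k^2)) \<in> O[at 0](\<lambda>k. k^6)"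
    by (simp flip: power_add)
  have "(\<lambda>k. w k - (L^2 / a * k^2 + (S * L^4 / a^3 - L^4 / (12 * a)) * k^4)) =
      (\<lambda>k. 1 / a * (E k + S * (d k * (w k + L^2 / a * k^2)) + (w k)^3 * R k))"
  proof
    fix k
    note aw[of k]
    also have "(w k)^2 = d k * (w k + L^2 / a * k^2) + L^4 / a^2 * k^4"
      by (simp add: d_def algebra_simps power2_eq_square power4_eq_xxxx)
    finally have "w k = 1 / a * (E k + (k * L)^2 - (k * L)^4 / 12
        + S * (d k * (w k + L^2 / a * k^2) + L^4 / a^2 * k^4) + (w k)^3 * R k)"
      using a by (simp add: eq_divide_eq mult.commute)
    then show "w k - (L^2 / a * k^2 + (S * L^4 / a^3 - L^4 / (12 * a)) * k^4) =
      1 / a * (E k + S * (d k * (w k + L^2 / a * k^2)) + (w k)^3 * R k)"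
      using a by (simp add: field_simps power2_eq_square power3_eq_cube power_mult_distrib)
  qed
  also have "\<dots> \<in> O[at 0](\<lambda>k. k^6)"
    using E dd w3R by (intro cmult sum_in_bigo)
  finally show ?thesis .
qed

section \<open>The branches of the spectrum\<close>

context
  fixes N :: nat and g :: "nat \<Rightarrow> real" and L :: real
  assumes N: "N \<ge> 3" and g: "\<And>n. n < N \<Longrightarrow> g n > 0"
begin

lemma dyn_matrix_rayleigh:
  assumes ev: "\<And>i. i < N \<Longrightarrow> (\<Sum>j<N. dyn_matrix N g L k $$ (i, j) * v j) = of_real x * v i"
  shows "x * (\<Sum>i<N. (cmod (v i))\<^sup>2) = bloch_energy N g (k * L) v"
proof -
  have "complex_of_real (bloch_energy N g (k * L) v) = (\<Sum>i<N. cnj (v i) * (of_real x * v i))"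
    unfolding dyn_matrix_energy[OF N, symmetric] using ev by (intro sum.cong) auto
  also have "\<dots> = of_real (x * (\<Sum>i<N. (cmod (v i))\<^sup>2))"
    by (simp add: sum_distrib_left complex_norm_square mult_ac del: of_real_power)
  finally show ?thesis by (simp only: of_real_eq_iff)
qed

text \<open>An eigenvector, continued as a Bloch wave, solves the recursion with multiplier
  \<open>cis (- (k * L))\<close>.\<close>

lemma discriminant_eigenvalue:
  assumes ev: "\<And>i. i < N \<Longrightarrow> (\<Sum>j<N. dyn_matrix N g L k $$ (i, j) * v j) = of_real x * v i"
    and nz: "\<exists>i<N. v i \<noteq> 0"
  shows "poly (discriminant (\<lambda>n. inverse (g n)) N) x = 2 * cos (k * L)"
proof (rule cis_root_cos)
  define u where "u = bloch_ext N (k * L) v"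
  define p where "p = bloch_flux N g (k * L) v"
  have p: "p (Suc n) = p n - of_real x * u n" if "n < N" for n
    using dyn_matrix_apply[OF N that, of g L k v] ev[OF that] that
    by (simp add: p_def u_def bloch_ext_def)
  have u: "u (Suc n) = u n + of_real (inverse (g n)) * p (Suc n)" if "n < N" for n
    using g[OF that] by (simp add: p_def u_def bloch_flux_def field_simps)
  \<comment> \<open>Zero initial data would propagate along the chain and make \<open>v\<close>
    vanish.\<close>
  have nz0: "u 0 \<noteq> 0 \<or> p 0 \<noteq> 0"
  proof (rule ccontr)
    assume "\<not> ?thesis"
    then have "u n = 0" if "n \<le> N" for n
      using transfer_solution[of N p x u "\<lambda>n. inverse (g n)" n, OF p u that] by simp
    moreover from nz obtain i where "i < N" "v i \<noteq> 0" by blast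
    ultimately have "u i = 0" by simp
    with \<open>i < N\<close> \<open>v i \<noteq> 0\<close> show False by (simp add: u_def bloch_ext_def)
  qed
  show "(cis (- (k * L)))\<^sup>2 - of_real (poly (discriminant (\<lambda>n. inverse (g n)) N) x) * cis (- (k * L)) + 1 = 0"
    using N by (intro discriminant_multiplier[of N p x u, OF p u _ _ nz0])
      (simp_all add: u_def p_def bloch_ext_period bloch_flux_period)
qed

text \<open>All three facts use the same orthogonal eigenvectors. The gap is a min-max argument: on
  their span the energy is at most the second eigenvalue times the squared norm, while a vector
  vanishing at site 0 obeys the Poincare bound.\<close>

lemma omega_sq_0_nonneg: "omega_sq N g L 0 k \<ge> 0"
  and omega_sq_1_lower: "1 \<le> real N * (\<Sum>n<N. 1 / sqrt (g n))\<^sup>2 * omega_sq N g L 1 k"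
  and discriminant_omega_sq_0:
    "poly (discriminant (\<lambda>n. inverse (g n)) N) (omega_sq N g L 0 k) = 2 * cos (k * L)"
proof -
  let ?A = "dyn_matrix N g L k"
  obtain p q where
    p: "\<And>i. i < N \<Longrightarrow> (\<Sum>j<N. ?A $$ (i, j) * p j) = of_real (omega_sq N g L 0 k) * p i"
    and q: "\<And>i. i < N \<Longrightarrow> (\<Sum>j<N. ?A $$ (i, j) * q j) = of_real (omega_sq N g L 1 k) * q i"
    and orth: "(\<Sum>i<N. cnj (p i) * q i) = 0"
    and p0: "\<exists>i<N. p i \<noteq> 0" and q0: "\<exists>i<N. q i \<noteq> 0"
    using hermitian_two_eigenvectors[OF dyn_matrix_carrier dyn_matrix_hermitian[OF N], of g L k] N
    by (auto simp: omega_sq_def)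
  show "poly (discriminant (\<lambda>n. inverse (g n)) N) (omega_sq N g L 0 k) = 2 * cos (k * L)"
    by (rule discriminant_eigenvalue[OF p p0])
  have pos: "(\<Sum>i<N. (cmod (v i))\<^sup>2) > 0" if "\<exists>i<N. v i \<noteq> 0" for v :: "nat \<Rightarrow> complex"
    using that by (auto intro: sum_pos2)
  show nonneg: "omega_sq N g L 0 k \<ge> 0"
    using dyn_matrix_rayleigh[OF p] pos[OF p0] bloch_energy_nonneg[of N g "k * L" p, OF g]
    by (metis zero_le_mult_iff not_less)
  \<comment> \<open>Chosen so that \<open>a * p 0 + b * q 0 = 0\<close>. If \<open>p 0 = 0\<close>
    this is \<open>p\<close> itself; otherwise \<open>b\<close> is nonzero, so the combination is
    nontrivial.\<close>
  define a b where "a = (if p 0 = 0 then 1 else q 0)" and "b = (if p 0 = 0 then 0 else - p 0)"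
  define v where "v i = a * p i + b * q i" for i
  define P Q where "P = (\<Sum>i<N. (cmod (p i))\<^sup>2)" and "Q = (\<Sum>i<N. (cmod (q i))\<^sup>2)"
  have v0: "v 0 = 0" by (simp add: v_def a_def b_def)
  \<comment> \<open>Orthogonality kills the cross terms. \<open>c = d = 1\<close> gives the norm,
    the two eigenvalues as \<open>c\<close> and \<open>d\<close> give the energy.\<close>
  have form: "(\<Sum>i<N. cnj (v i) * (c * a * p i + d * b * q i))
      = c * of_real ((cmod a)\<^sup>2 * P) + d * of_real ((cmod b)\<^sup>2 * Q)" for c d
  proof -
    have "cnj (v i) * (c * a * p i + d * b * q i)
        = c * of_real ((cmod a)\<^sup>2) * of_real ((cmod (p i))\<^sup>2) + d * of_real ((cmod b)\<^sup>2) * of_real ((cmod (q i))\<^sup>2)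
          + cnj a * d * b * (cnj (p i) * q i) + cnj b * c * a * cnj (cnj (p i) * q i)" for i
      by (simp add: v_def complex_norm_square algebra_simps del: of_real_power)
    then have "(\<Sum>i<N. cnj (v i) * (c * a * p i + d * b * q i))
        = c * of_real ((cmod a)\<^sup>2) * of_real P + d * of_real ((cmod b)\<^sup>2) * of_real Q
          + cnj a * d * b * (\<Sum>i<N. cnj (p i) * q i) + cnj b * c * a * cnj (\<Sum>i<N. cnj (p i) * q i)"
      unfolding P_def Q_def of_real_sum cnj_sum by (simp only: sum.distrib sum_distrib_left)
    then show ?thesis by (simp only: orth) simp
  qed
  have norm: "(\<Sum>i<N. (cmod (v i))\<^sup>2) = (cmod a)\<^sup>2 * P + (cmod b)\<^sup>2 * Q"
  proof -
    have "complex_of_real (\<Sum>i<N. (cmod (v i))\<^sup>2) = (\<Sum>i<N. cnj (v i) * (1 * a * p i + 1 * b * q i))"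
      unfolding of_real_sum
      by (intro sum.cong refl) (simp add: complex_norm_square v_def mult.commute del: of_real_power)
    also have "\<dots> = of_real ((cmod a)\<^sup>2 * P + (cmod b)\<^sup>2 * Q)"
      unfolding form by simp
    finally show ?thesis by (simp only: of_real_eq_iff)
  qed
  have energy: "bloch_energy N g (k * L) v
      = omega_sq N g L 0 k * ((cmod a)\<^sup>2 * P) + omega_sq N g L 1 k * ((cmod b)\<^sup>2 * Q)"
  proof -
    have "(\<Sum>j<N. ?A $$ (i, j) * v j)
        = of_real (omega_sq N g L 0 k) * a * p i + of_real (omega_sq N g L 1 k) * b * q i" if "i < N" for i
    proof -
      have "(\<Sum>j<N. ?A $$ (i, j) * v j) = a * (\<Sum>j<N. ?A $$ (i, j) * p j) + b * (\<Sum>j<N. ?A $$ (i, j) * q j)"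
        by (simp add: v_def algebra_simps sum.distrib sum_distrib_left)
      then show ?thesis unfolding p[OF that] q[OF that] by (simp add: mult_ac)
    qed
    then have "complex_of_real (bloch_energy N g (k * L) v) = (\<Sum>i<N. cnj (v i) *
        (of_real (omega_sq N g L 0 k) * a * p i + of_real (omega_sq N g L 1 k) * b * q i))"
      unfolding dyn_matrix_energy[OF N, symmetric] by (intro sum.cong) auto
    also have "\<dots> = of_real (omega_sq N g L 0 k * ((cmod a)\<^sup>2 * P) + omega_sq N g L 1 k * ((cmod b)\<^sup>2 * Q))"
      unfolding form by simp
    finally show ?thesis by (simp only: of_real_eq_iff)
  qed
  define K where "K = real N * (\<Sum>n<N. 1 / sqrt (g n))\<^sup>2"
  have le: "omega_sq N g L 0 k \<le> omega_sq N g L 1 k"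
    unfolding omega_sq_def using N by (intro sorted_eigenvalues_mono[OF dyn_matrix_carrier]) auto
  have PQ: "P > 0" "Q > 0" unfolding P_def Q_def by (intro pos p0 q0)+
  then have n0: "(cmod a)\<^sup>2 * P + (cmod b)\<^sup>2 * Q > 0"
    by (cases "p 0 = 0") (auto simp: a_def b_def intro!: add_nonneg_pos)
  have "(cmod a)\<^sup>2 * P + (cmod b)\<^sup>2 * Q \<le> K * bloch_energy N g (k * L) v"
    using bloch_poincare[of N g v "k * L", OF g v0] unfolding norm K_def .
  also have "bloch_energy N g (k * L) v \<le> omega_sq N g L 1 k * ((cmod a)\<^sup>2 * P + (cmod b)\<^sup>2 * Q)"
    unfolding energy distrib_left using le PQ by (intro add_right_mono mult_right_mono) auto
  finally have "1 * ((cmod a)\<^sup>2 * P + (cmod b)\<^sup>2 * Q) \<le> (K * omega_sq N g L 1 k) * ((cmod a)\<^sup>2 * P + (cmod b)\<^sup>2 * Q)"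
    by (simp add: K_def mult_left_mono mult.assoc)
  then show "1 \<le> real N * (\<Sum>n<N. 1 / sqrt (g n))\<^sup>2 * omega_sq N g L 1 k"
    using n0 unfolding K_def by (simp only: mult_le_cancel_right_pos)
qed

section \<open>Limits of the branches at k = 0\<close>

lemma det_dyn_matrix_0: "det (dyn_matrix N g L 0) = 0"
proof -
  \<comment> \<open>At zero phase a constant displacement produces no bond force.\<close>
  have "(\<Sum>j<N. dyn_matrix N g L 0 $$ (i, j) * 1) = 0" if "i < N" for i
    unfolding dyn_matrix_apply[OF N that] by (cases i) (simp_all add: bloch_flux_def bloch_ext_def)
  then have "dyn_matrix N g L 0 *\<^sub>v vec N (\<lambda>_. 1) = 0\<^sub>v N"
    by (intro eq_vecI) (simp_all add: scalar_prod_def atLeast0LessThan dyn_matrix_def)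
  moreover have "vec N (\<lambda>_. 1 :: complex) \<noteq> 0\<^sub>v N"
    using N by (auto simp: vec_eq_iff intro!: exI[of _ 0])
  ultimately show ?thesis
    using det_0_iff_vec_prod_zero[OF dyn_matrix_carrier, of N g L 0] by (auto intro!: exI[of _ "vec N (\<lambda>_. 1)"])
qed

text \<open>The lowest eigenvalue is nonnegative, so its N-th power is at most the product of all of
  them, the determinant, which tends to 0 by continuity of the entries.\<close>

lemma omega_sq_0_tendsto: "(omega_sq N g L 0 \<longlongrightarrow> 0) (at 0)"
proof -
  have entry: "((\<lambda>k. dyn_matrix N g L k $$ (i, j)) \<longlongrightarrow> dyn_matrix N g L 0 $$ (i, j)) (at 0)"
    if "i < N" "j < N" for i j
    using that by (auto simp: dyn_matrix_def cis_conv_exp intro!: tendsto_eq_intros)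
  have "((\<lambda>k. det (dyn_matrix N g L k)) \<longlongrightarrow> det (dyn_matrix N g L 0)) (at 0)"
    unfolding det_def'[OF dyn_matrix_carrier]
    by (intro tendsto_sum tendsto_mult tendsto_const tendsto_prod entry)
      (auto simp: permutes_in_image dest: permutes_in_image)
  then have lim: "((\<lambda>k. cmod (det (dyn_matrix N g L k))) \<longlongrightarrow> 0) (at 0)"
    by (simp add: det_dyn_matrix_0 tendsto_norm_zero)
  have bound: "norm (omega_sq N g L 0 k ^ N) \<le> cmod (det (dyn_matrix N g L k))" for k
  proof -
    have "omega_sq N g L 0 k ^ N = (\<Prod>i<N. omega_sq N g L 0 k)" by simp
    also have "\<dots> \<le> (\<Prod>i<N. omega_sq N g L i k)"
      using omega_sq_0_nonneg
      by (intro prod_mono) (auto simp: omega_sq_def intro!: sorted_eigenvalues_mono[OF dyn_matrix_carrier])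
    also have "\<dots> \<le> cmod (det (dyn_matrix N g L k))"
      unfolding sorted_eigenvalues_det[OF dyn_matrix_carrier dyn_matrix_hermitian[OF N]] norm_of_real
      by (simp add: omega_sq_def)
    finally show ?thesis using omega_sq_0_nonneg[of k] by simp
  qed
  have "((\<lambda>k. omega_sq N g L 0 k ^ N) \<longlongrightarrow> 0) (at 0)"
    by (rule tendsto_0_le[OF lim, where K = 1]) (use bound in simp)
  then show ?thesis using N by simp
qed

text \<open>Every higher branch dominates branch 1, which has a positive lower bound independent of
  k.\<close>

lemma omega_sq_tendsto_0_iff:
  assumes n: "n < N"
  shows "(omega_sq N g L n \<longlongrightarrow> 0) (at 0) \<longleftrightarrow> n = 0"
proof
  assume lim: "(omega_sq N g L n \<longlongrightarrow> 0) (at 0)"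
  show "n = 0"
  proof (rule ccontr)
    assume "n \<noteq> 0"
    define K where "K = real N * (\<Sum>n<N. 1 / sqrt (g n))\<^sup>2"
    have "1 \<le> K * omega_sq N g L n k" for k
    proof -
      have "omega_sq N g L 1 k \<le> omega_sq N g L n k"
        unfolding omega_sq_def using n \<open>n \<noteq> 0\<close>
        by (intro sorted_eigenvalues_mono[OF dyn_matrix_carrier]) auto
      then have "K * omega_sq N g L 1 k \<le> K * omega_sq N g L n k"
        by (intro mult_left_mono) (simp_all add: K_def)
      with omega_sq_1_lower[of k] show ?thesis by (simp add: K_def)
    qed
    moreover have "((\<lambda>k. K * omega_sq N g L n k) \<longlongrightarrow> K * 0) (at 0)"
      by (intro tendsto_intros lim)
    ultimately have "1 \<le> K * 0"
      by (intro tendsto_lowerbound[OF _ always_eventually]) auto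
    then show False by simp
  qed
qed (simp add: omega_sq_0_tendsto)

text \<open>\<open>- a\<close> and \<open>S\<close> are the linear and quadratic coefficients of the
  trace; the lowest branch tends to 0, so the inversion applies to it.\<close>

lemma omega_sq_0_expansion:
  assumes L: "L > 0"
  defines "a \<equiv> real N * (\<Sum>n<N. inverse (g n))"
    and "S \<equiv> \<Sum>j<N. \<Sum>i<j. c_coeff N i j * inverse (g i) * inverse (g j)"
  shows "(\<lambda>k. omega_sq N g L 0 k - (L^2 / a * k^2 + (S * L^4 / a^3 - L^4 / (12 * a)) * k^4))
    \<in> O[at 0](\<lambda>k. k^6)"
proof -
  obtain r where r: "\<And>x. poly (discriminant (\<lambda>n. inverse (g n)) N) x = 2 - a * x + S * x^2 + x^3 * poly r x"
    using poly_discriminant[of "\<lambda>n. inverse (g n)" N] unfolding a_def S_def by blast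
  have "a > 0"
    unfolding a_def using N g by (intro mult_pos_pos sum_pos) (auto simp: lessThan_empty_iff)
  then show ?thesis
    using L omega_sq_0_tendsto
    by (rule implicit_dispersion_expansion[where r = r]) (simp add: r flip: discriminant_omega_sq_0)
qed

end

theorem mainTheorem1:
  fixes N :: nat and g l :: "nat \<Rightarrow> real" and L :: real
  assumes "N \<ge> 3"
    and "\<And>n. n < N \<Longrightarrow> g n > 0"
    and "\<And>n. n < N \<Longrightarrow> l n = g n powr (- 1 / 2)"
    and "L = (\<Sum>n<N. l n)"
  shows "(\<forall>n<N. (omega_sq N g L n \<longlongrightarrow> 0) (at 0) \<longleftrightarrow> n = 0)
    \<and> (\<lambda>k. omega_sq N g L 0 k -
           (L^2 / real N^2 * (1 / avg N (\<lambda>n. inverse (g n))) * k^2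
            + (L^4 / real N^6
                 * ((\<Sum>j<N. \<Sum>i<j. c_coeff N i j * inverse (g i) * inverse (g j))
                    / (avg N (\<lambda>n. inverse (g n)))^3)
               - 1 / (12 * real N^2) * (L^4 / avg N (\<lambda>n. inverse (g n)))) * k^4))
         \<in> O[at 0](\<lambda>k. k^6)
    \<and> (\<lambda>k. omega_sq N g L 0 k -
           ((avg N l)^2 / avg N (\<lambda>n. (l n)^2) * k^2
            + (1 / L^2 * ((avg N l)^6 / (avg N (\<lambda>n. (l n)^2))^3)
                 * (\<Sum>j<N. \<Sum>i<j. c_coeff N i j * (l i)^2 * (l j)^2)
               - L^2 / 12 * ((avg N l)^2 / avg N (\<lambda>n. (l n)^2))) * k^4))
         \<in> O[at 0](\<lambda>k. k^6)"
proof (intro conjI allI impI)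
  have l_pos: "l n > 0" if "n < N" for n
    using assms(2)[OF that] by (simp add: assms(3)[OF that])
  then have L: "L > 0"
    unfolding assms(4) using assms(1) by (intro sum_pos) (auto simp: lessThan_empty_iff)
  have l2: "(l n)^2 = inverse (g n)" if "n < N" for n
    using assms(2)[OF that] by (simp add: assms(3)[OF that] powr_minus powr_half_sqrt power_inverse)
  define G where "G = (\<Sum>n<N. inverse (g n))"
  define S where "S = (\<Sum>j<N. \<Sum>i<j. c_coeff N i j * inverse (g i) * inverse (g j))"
  have G: "G > 0"
    unfolding G_def using assms(1,2) by (intro sum_pos) (auto simp: lessThan_empty_iff)
  have N: "real N > 0" using assms(1) by simp
  have avg_g: "avg N (\<lambda>n. inverse (g n)) = G / real N" and avg_l: "avg N l = L / real N"
    by (simp_all add: avg_def G_def assms(4))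
  have avg_l2: "avg N (\<lambda>n. (l n)^2) = G / real N"
    by (simp add: avg_def G_def l2)
  have S_l: "(\<Sum>j<N. \<Sum>i<j. c_coeff N i j * (l i)^2 * (l j)^2) = S"
    unfolding S_def by (intro sum.cong) (auto simp: l2)
  have expansion: "(\<lambda>k. omega_sq N g L 0 k - (L^2 / (real N * G) * k^2
      + (S * L^4 / (real N * G)^3 - L^4 / (12 * (real N * G))) * k^4)) \<in> O[at 0](\<lambda>k. k^6)"
    unfolding G_def S_def by (rule omega_sq_0_expansion[OF assms(1,2) L])
  show "(omega_sq N g L n \<longlongrightarrow> 0) (at 0) \<longleftrightarrow> n = 0" if "n < N" for n
    by (rule omega_sq_tendsto_0_iff[OF assms(1,2) that])
  \<comment> \<open>The powers of \<open>N\<close> from averages and prefactors combine into those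
    of \<open>real N * G\<close>.\<close>
  have "L^2 / real N^2 * (1 / (G / real N)) = L^2 / (real N * G)"
    "L^4 / real N^6 * (S / (G / real N)^3) - 1 / (12 * real N^2) * (L^4 / (G / real N))
      = S * L^4 / (real N * G)^3 - L^4 / (12 * (real N * G))"
    using G N by (simp_all add: field_simps eval_nat_numeral)
  with expansion show "(\<lambda>k. omega_sq N g L 0 k -
           (L^2 / real N^2 * (1 / avg N (\<lambda>n. inverse (g n))) * k^2
            + (L^4 / real N^6
                 * ((\<Sum>j<N. \<Sum>i<j. c_coeff N i j * inverse (g i) * inverse (g j))
                    / (avg N (\<lambda>n. inverse (g n)))^3)
               - 1 / (12 * real N^2) * (L^4 / avg N (\<lambda>n. inverse (g n)))) * k^4))
         \<in> O[at 0](\<lambda>k. k^6)"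
    unfolding avg_g S_def[symmetric] by (simp only:)
  have "(L / real N)^2 / (G / real N) = L^2 / (real N * G)"
    "1 / L^2 * ((L / real N)^6 / (G / real N)^3) * S - L^2 / 12 * ((L / real N)^2 / (G / real N))
      = S * L^4 / (real N * G)^3 - L^4 / (12 * (real N * G))"
    using G N L by (simp_all add: field_simps eval_nat_numeral)
  with expansion show "(\<lambda>k. omega_sq N g L 0 k -
           ((avg N l)^2 / avg N (\<lambda>n. (l n)^2) * k^2
            + (1 / L^2 * ((avg N l)^6 / (avg N (\<lambda>n. (l n)^2))^3)
                 * (\<Sum>j<N. \<Sum>i<j. c_coeff N i j * (l i)^2 * (l j)^2)
               - L^2 / 12 * ((avg N l)^2 / avg N (\<lambda>n. (l n)^2))) * k^4))
         \<in> O[at 0](\<lambda>k. k^6)"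
    unfolding avg_l avg_l2 S_l by (simp only:)
qed

end
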